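(* Let $R$ be a hemiring. Each fuzzy $h$-ideal of $R$ is idempotent if and only if each non-constant fuzzy $h$-ideal of $R$ is semiprime (in the sense of the $h$-intrinsic product).
   Context: A hemiring is a set $R$ with operations $+$ and $\cdot$ such that $(R,+)$ is a commutative semigroup, $(R,\cdot)$ is a semigroup, multiplication distributes over addition on both sides, and there is $0\in R$ with $a+0=0+a=a$ and $a0=0a=0$ for all $a\in R$. A fuzzy subset of $R$ is a map $\lambda:R\to[0,1]$. Write $\lambda\leq\mu$ if $\lambda(x)\leq\mu(x)$ for all $x\in R$; $\wedge$ denotes (pointwise) minimum. A fuzzy $h$-ideal of $R$ is a fuzzy subset $\lambda$ such that for all $a,b,x,y\in R$: $\lambda(a+b)\geq\lambda(a)\wedge\lambda(b)$; $\lambda(ab)\geq\lambda(a)$ and $\lambda(ab)\geq\lambda(b)$; and $x+a+y=b+y$ implies $\lambda(x)\geq\lambda(a)\wedge\lambda(b)$. The $h$-intrinsic product of fuzzy subsets $\mu,\nu$ is $(\mu\odot_h\nu)(x)=\sup\big(\bigwedge_{i=1}^m(\mu(a_i)\wedge\nu(b_i))\wedge\bigwedge_{j=1}^n(\mu(a_j')\wedge\nu(b_j'))\big)$, the supremum being over all expressions $x+\sum_{i=1}^m a_ib_i+z=\sum_{j=1}^n a_j'b_j'+z$ with $m,n\geq1$ and $a_i,b_i,a_j',b_j',z\in R$, and $(\mu\odot_h\nu)(x)=0$ if no such expression exists. A fuzzy $h$-ideal $\lambda$ is idempotent if $\lambda\odot_h\lambda=\lambda$. A non-constant fuzzy $h$-ideal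 $\lambda$ is semiprime if for any fuzzy $h$-ideal $\delta$ of $R$, $\delta\odot_h\delta\leq\lambda$ implies $\delta\leq\lambda$. *)

theory Defs
  imports Complex_Main
begin

text \<open>
  Hemirings are the types of class \<^class>\<open>semiring_0\<close>: commutative additive monoid with an
  absorbing zero, associative multiplication (not assumed commutative or unital), and both
  distributive laws.  The order on fuzzy subsets is the library's pointwise order on functions.
\<close>

definition fuzzy_subset :: "('a \<Rightarrow> real) \<Rightarrow> bool" where
  "fuzzy_subset \<mu> \<longleftrightarrow> (\<forall>x. 0 \<le> \<mu> x \<and> \<mu> x \<le> 1)"

definition fuzzy_h_ideal :: "('a::semiring_0 \<Rightarrow> real) \<Rightarrow> bool" where
  "fuzzy_h_ideal \<mu> \<longleftrightarrow> fuzzy_subset \<mu> \<and>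
     (\<forall>a b. \<mu> (a + b) \<ge> min (\<mu> a) (\<mu> b)) \<and>
     (\<forall>a b. \<mu> (a * b) \<ge> \<mu> a) \<and>
     (\<forall>a b. \<mu> (a * b) \<ge> \<mu> b) \<and>
     (\<forall>a b x y. x + a + y = b + y \<longrightarrow> \<mu> x \<ge> min (\<mu> a) (\<mu> b))"

definition h_product_values ::
  "('a::semiring_0 \<Rightarrow> real) \<Rightarrow> ('a \<Rightarrow> real) \<Rightarrow> 'a \<Rightarrow> real set" where
  "h_product_values \<mu> \<nu> x =
     {min (Min ((\<lambda>i. min (\<mu> (a i)) (\<nu> (b i))) ` {1..m}))
          (Min ((\<lambda>j. min (\<mu> (a' j)) (\<nu> (b' j))) ` {1..n}))
      | (m::nat) (n::nat) (a::nat \<Rightarrow> 'a) b a' b' z.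
        m \<ge> 1 \<and> n \<ge> 1 \<and>
        x + (\<Sum>i=1..m. a i * b i) + z = (\<Sum>j=1..n. a' j * b' j) + z}"

text \<open>The case split is needed because \<^term>\<open>Sup {} :: real\<close> is unspecified.\<close>

definition h_product ::
  "('a::semiring_0 \<Rightarrow> real) \<Rightarrow> ('a \<Rightarrow> real) \<Rightarrow> 'a \<Rightarrow> real"  (infixl "\<odot>\<^sub>h" 70) where
  "(\<mu> \<odot>\<^sub>h \<nu>) x =
     (if h_product_values \<mu> \<nu> x = {} then 0 else Sup (h_product_values \<mu> \<nu> x))"

definition idempotent_fuzzy_h_ideal :: "('a::semiring_0 \<Rightarrow> real) \<Rightarrow> bool" where
  "idempotent_fuzzy_h_ideal \<mu> \<longleftrightarrow> fuzzy_h_ideal \<mu> \<and> \<mu> \<odot>\<^sub>h \<mu> = \<mu>"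

definition nonconstant :: "('a \<Rightarrow> real) \<Rightarrow> bool" where
  "nonconstant \<mu> \<longleftrightarrow> \<not> (\<exists>c. \<forall>x. \<mu> x = c)"

definition semiprime_fuzzy_h_ideal :: "('a::semiring_0 \<Rightarrow> real) \<Rightarrow> bool" where
  "semiprime_fuzzy_h_ideal \<mu> \<longleftrightarrow> fuzzy_h_ideal \<mu> \<and> nonconstant \<mu> \<and>
     (\<forall>\<delta>. fuzzy_h_ideal \<delta> \<longrightarrow> \<delta> \<odot>\<^sub>h \<delta> \<le> \<mu> \<longrightarrow> \<delta> \<le> \<mu>)"

end

(* If every non-constant fuzzy h-ideal is semiprime, apply semiprimeness of mu o mu to mu itself,
   where o is the h-intrinsic product: mu o mu is a fuzzy h-ideal below mu, so if it is
   non-constant, then mu <= mu o mu.  If it is constant, its value is (mu o mu)(0) >= mu(0), and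
   mu(0) is the maximum of mu, so again mu <= mu o mu.

   To see that mu o nu is a fuzzy h-ideal, pass to upper level sets: with A = {mu >= t} and
   B = {nu >= t}, up to suprema (mu o nu)(x) >= t says that x + s + z = s' + z for some finite
   sums s, s' of products from A and B. *)
theory Submission
  imports Defs
begin

section \<open>Nonempty finite sums of products from two sets\<close>

inductive_set product_sums :: "'a::semiring_0 set \<Rightarrow> 'a set \<Rightarrow> 'a set" for A B where
  prod: "a \<in> A \<Longrightarrow> b \<in> B \<Longrightarrow> a * b \<in> product_sums A B"
| add_prod: "s \<in> product_sums A B \<Longrightarrow> a \<in> A \<Longrightarrow> b \<in> B \<Longrightarrow> s + a * b \<in> product_sums A B"

text \<open>Bridge between the indexed sums in \<open>h_product_values\<close> and the inductive
  form, whose closure properties follow by rule induction without handling indices. Starting the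
  induction from a single product, not from 0, mirrors the condition
  \<open>m \<ge> 1\<close>.\<close>

lemma product_sums_iff:
  "s \<in> product_sums A B \<longleftrightarrow>
     (\<exists>(m::nat) a b. m \<ge> 1 \<and> (\<forall>i\<in>{1..m}. a i \<in> A \<and> b i \<in> B) \<and> s = (\<Sum>i=1..m. a i * b i))"
proof
  assume "s \<in> product_sums A B"
  then show "\<exists>(m::nat) a b. m \<ge> 1 \<and> (\<forall>i\<in>{1..m}. a i \<in> A \<and> b i \<in> B) \<and> s = (\<Sum>i=1..m. a i * b i)"
  proof induction
    case (prod a b)
    then show ?case
      by - (rule exI[of _ 1], rule exI[of _ "\<lambda>_. a"], rule exI[of _ "\<lambda>_::nat. b"], simp)
  next
    case (add_prod s a b)
    then obtain m :: nat and f g where mfg: "m \<ge> 1" "\<forall>i\<in>{1..m}. f i \<in> A \<and> g i \<in> B"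
      "s = (\<Sum>i=1..m. f i * g i)"
      by blast
    have "(\<Sum>i=1..m. (f(Suc m := a)) i * (g(Suc m := b)) i) = (\<Sum>i=1..m. f i * g i)"
      by (rule sum.cong) auto
    with mfg add_prod.hyps show ?case
      by - (rule exI[of _ "Suc m"], rule exI[of _ "f(Suc m := a)"],
        rule exI[of _ "g(Suc m := b)"], simp)
  qed
next
  assume "\<exists>(m::nat) a b. m \<ge> 1 \<and> (\<forall>i\<in>{1..m}. a i \<in> A \<and> b i \<in> B) \<and> s = (\<Sum>i=1..m. a i * b i)"
  then obtain m :: nat and a b where "m \<ge> 1" "\<forall>i\<in>{1..m}. a i \<in> A \<and> b i \<in> B"
    "s = (\<Sum>i=1..m. a i * b i)"
    by blast
  moreover from this(1,2) have "(\<Sum>i=1..m. a i * b i) \<in> product_sums A B"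
    by (induction m rule: nat_induct_at_least) (auto intro: product_sums.intros)
  ultimately show "s \<in> product_sums A B"
    by simp
qed

lemma product_sums_mono:
  assumes "A \<subseteq> A'" and "B \<subseteq> B'"
  shows "product_sums A B \<subseteq> product_sums A' B'"
proof
  fix s assume "s \<in> product_sums A B"
  then show "s \<in> product_sums A' B'"
    using assms by induction (auto intro: product_sums.intros)
qed

lemma product_sums_add:
  assumes "s \<in> product_sums A B" and "s' \<in> product_sums A B"
  shows "s + s' \<in> product_sums A B"
  using assms(2,1)
  by induction (auto simp: add.assoc[symmetric] intro: product_sums.intros)

text \<open>The outer factor moves into the right-hand set:
  \<open>(a * b) * y = a * (b * y)\<close>.\<close>

lemma product_sums_mult_right:
  assumes "s \<in> product_sums A B" and "\<And>b. b \<in> B \<Longrightarrow> b * y \<in> B"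
  shows "s * y \<in> product_sums A B"
  using assms(1)
  by induction (auto simp: distrib_right mult.assoc intro: product_sums.intros assms(2))

lemma product_sums_mult_left:
  assumes "s \<in> product_sums A B" and "\<And>a. a \<in> A \<Longrightarrow> y * a \<in> A"
  shows "y * s \<in> product_sums A B"
  using assms(1)
  by induction (auto simp: distrib_left mult.assoc[symmetric] intro: product_sums.intros assms(2))

section \<open>The h-closure of a set and its stability properties\<close>

definition h_closure :: "'a::semiring_0 set \<Rightarrow> 'a set" where
  "h_closure S = {x. \<exists>s\<in>S. \<exists>s'\<in>S. \<exists>z. x + s + z = s' + z}"

lemma h_closureI: "x + s + z = s' + z \<Longrightarrow> s \<in> S \<Longrightarrow> s' \<in> S \<Longrightarrow> x \<in> h_closure S"
  unfolding h_closure_def by blast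

lemma h_closureE:
  assumes "x \<in> h_closure S"
  obtains s s' z where "s \<in> S" "s' \<in> S" "x + s + z = s' + z"
  using assms unfolding h_closure_def by blast

lemma h_closure_add:
  assumes S: "\<And>s s'. s \<in> S \<Longrightarrow> s' \<in> S \<Longrightarrow> s + s' \<in> S"
    and "x \<in> h_closure S" and "y \<in> h_closure S"
  shows "x + y \<in> h_closure S"
proof -
  obtain s s' z where x: "s \<in> S" "s' \<in> S" "x + s + z = s' + z"
    using assms(2) by (rule h_closureE)
  obtain t t' w where y: "t \<in> S" "t' \<in> S" "y + t + w = t' + w"
    using assms(3) by (rule h_closureE)
  have "(x + y) + (s + t) + (z + w) = (x + s + z) + (y + t + w)"
    by (simp add: ac_simps)
  also have "\<dots> = (s' + t') + (z + w)"
    unfolding x(3) y(3) by (simp add: ac_simps)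
  finally have "(x + y) + (s + t) + (z + w) = (s' + t') + (z + w)" .
  from h_closureI[OF this] show ?thesis
    using S x y by blast
qed

lemma h_closure_mult_right:
  assumes "x \<in> h_closure S" and "\<And>s. s \<in> S \<Longrightarrow> s * y \<in> S"
  shows "x * y \<in> h_closure S"
proof -
  obtain s s' z where x: "s \<in> S" "s' \<in> S" "x + s + z = s' + z"
    using assms(1) by (rule h_closureE)
  have "x * y + s * y + z * y = s' * y + z * y"
    using arg_cong[OF x(3), of "\<lambda>u. u * y"] by (simp only: distrib_right)
  from h_closureI[OF this] show ?thesis
    using x assms(2) by blast
qed

lemma h_closure_mult_left:
  assumes "x \<in> h_closure S" and "\<And>s. s \<in> S \<Longrightarrow> y * s \<in> S"
  shows "y * x \<in> h_closure S"
proof -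
  obtain s s' z where x: "s \<in> S" "s' \<in> S" "x + s + z = s' + z"
    using assms(1) by (rule h_closureE)
  have "y * x + y * s + y * z = y * s' + y * z"
    using arg_cong[OF x(3), of "\<lambda>u. y * u"] by (simp only: distrib_left)
  from h_closureI[OF this] show ?thesis
    using x assms(2) by blast
qed

text \<open>Adding \<open>s + z + t + w\<close> to both sides of \<open>eq\<close> turns
  \<open>a + s + z\<close> into \<open>s' + z\<close> and \<open>b + t + w\<close> into
  \<open>t' + w\<close>. Hence \<open>s' + t\<close> and \<open>t' + s\<close> witness membership of
  \<open>x\<close>, with \<open>z + w + y\<close> as the term common to both sides.\<close>

lemma h_closure_cancel:
  assumes S: "\<And>s s'. s \<in> S \<Longrightarrow> s' \<in> S \<Longrightarrow> s + s' \<in> S"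
    and "a \<in> h_closure S" and "b \<in> h_closure S" and eq: "x + a + y = b + y"
  shows "x \<in> h_closure S"
proof -
  obtain s s' z where a: "s \<in> S" "s' \<in> S" "a + s + z = s' + z"
    using assms(2) by (rule h_closureE)
  obtain t t' w where b: "t \<in> S" "t' \<in> S" "b + t + w = t' + w"
    using assms(3) by (rule h_closureE)
  have "x + (s' + t) + (z + w + y) = x + (s' + z) + t + w + y"
    by (simp add: ac_simps)
  also have "\<dots> = (x + a + y) + s + z + t + w"
    unfolding a(3)[symmetric] by (simp add: ac_simps)
  also have "\<dots> = (b + t + w) + s + z + y"
    unfolding eq by (simp add: ac_simps)
  also have "\<dots> = (t' + s) + (z + w + y)"
    unfolding b(3) by (simp add: ac_simps)
  finally have "x + (s' + t) + (z + w + y) = (t' + s) + (z + w + y)" .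
  from h_closureI[OF this] show ?thesis
    using S a b by blast
qed

section \<open>Level sets of the intrinsic product\<close>

definition level :: "('a \<Rightarrow> real) \<Rightarrow> real \<Rightarrow> 'a set" where
  "level \<mu> t = {x. t \<le> \<mu> x}"

text \<open>Because the supremum need not be attained, this is not the level set of the product
  itself. For fuzzy \<mu> and \<open>0 \<le> t\<close> it lies between the set where the product
  exceeds \<open>t\<close> and the set where it is at least \<open>t\<close>.\<close>

definition h_product_level ::
  "('a::semiring_0 \<Rightarrow> real) \<Rightarrow> ('a \<Rightarrow> real) \<Rightarrow> real \<Rightarrow> 'a set" where
  "h_product_level \<mu> \<nu> t = h_closure (product_sums (level \<mu> t) (level \<nu> t))"

lemma le_Min_min_iff:
  fixes \<mu> \<nu> :: "'a \<Rightarrow> real"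
  assumes "m \<ge> (1::nat)"
  shows "t \<le> Min ((\<lambda>i. min (\<mu> (a i)) (\<nu> (b i))) ` {1..m}) \<longleftrightarrow>
         (\<forall>i\<in>{1..m}. a i \<in> level \<mu> t \<and> b i \<in> level \<nu> t)"
  using assms by (subst Min_ge_iff) (auto simp: level_def)

text \<open>A minimum over a nonempty finite family is at least \<open>t\<close> exactly when every
  member is, so a single expression has value at least \<open>t\<close> iff all its factors lie in
  the level sets.\<close>

lemma h_product_level_iff:
  "x \<in> h_product_level \<mu> \<nu> t \<longleftrightarrow> (\<exists>v\<in>h_product_values \<mu> \<nu> x. t \<le> v)"
proof
  assume "x \<in> h_product_level \<mu> \<nu> t"
  then obtain s s' z where s: "s \<in> product_sums (level \<mu> t) (level \<nu> t)"
    and s': "s' \<in> product_sums (level \<mu> t) (level \<nu> t)" and eq: "x + s + z = s' + z"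
    unfolding h_product_level_def by (rule h_closureE)
  obtain m :: nat and a b where m: "m \<ge> 1"
    "\<forall>i\<in>{1..m}. a i \<in> level \<mu> t \<and> b i \<in> level \<nu> t" "s = (\<Sum>i=1..m. a i * b i)"
    using s unfolding product_sums_iff by blast
  obtain n :: nat and a' b' where n: "n \<ge> 1" "\<forall>i\<in>{1..n}. a' i \<in> level \<mu> t \<and> b' i \<in> level \<nu> t"
      "s' = (\<Sum>i=1..n. a' i * b' i)"
    using s' unfolding product_sums_iff by blast
  let ?v = "min (Min ((\<lambda>i. min (\<mu> (a i)) (\<nu> (b i))) ` {1..m}))
                (Min ((\<lambda>j. min (\<mu> (a' j)) (\<nu> (b' j))) ` {1..n}))"
  have "?v \<in> h_product_values \<mu> \<nu> x"
    unfolding h_product_values_def using m n eq by blast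
  moreover have "t \<le> ?v"
    using m n by (simp only: le_Min_min_iff min.bounded_iff)
  ultimately show "\<exists>v\<in>h_product_values \<mu> \<nu> x. t \<le> v"
    by blast
next
  assume "\<exists>v\<in>h_product_values \<mu> \<nu> x. t \<le> v"
  then obtain m n :: nat and a b a' b' z where
    mn: "m \<ge> 1" "n \<ge> 1"
    and eq: "x + (\<Sum>i=1..m. a i * b i) + z = (\<Sum>j=1..n. a' j * b' j) + z"
    and t: "t \<le> Min ((\<lambda>i. min (\<mu> (a i)) (\<nu> (b i))) ` {1..m})"
      "t \<le> Min ((\<lambda>j. min (\<mu> (a' j)) (\<nu> (b' j))) ` {1..n})"
    unfolding h_product_values_def by auto
  show "x \<in> h_product_level \<mu> \<nu> t"
    unfolding h_product_level_def
    using eq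
  proof (rule h_closureI)
    show "(\<Sum>i=1..m. a i * b i) \<in> product_sums (level \<mu> t) (level \<nu> t)"
      unfolding product_sums_iff using mn(1) t(1) unfolding le_Min_min_iff[OF mn(1)] by blast
    show "(\<Sum>j=1..n. a' j * b' j) \<in> product_sums (level \<mu> t) (level \<nu> t)"
      unfolding product_sums_iff using mn(2) t(2) unfolding le_Min_min_iff[OF mn(2)] by blast
  qed
qed

text \<open>Taking \<open>v\<close> itself as threshold, some sum over the level sets exists; being
  nonempty, it contains a left factor of grade at least \<open>v\<close>.\<close>

lemma h_product_values_le_one:
  assumes "fuzzy_subset \<mu>" and "v \<in> h_product_values \<mu> \<nu> x"
  shows "v \<le> 1"
proof -
  have "x \<in> h_product_level \<mu> \<nu> v"
    using assms(2) h_product_level_iff by blast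
  then obtain s where "s \<in> product_sums (level \<mu> v) (level \<nu> v)"
    unfolding h_product_level_def by (rule h_closureE)
  then obtain a where "v \<le> \<mu> a"
    by cases (auto simp: level_def)
  then show ?thesis
    using assms(1) unfolding fuzzy_subset_def by (meson order_trans)
qed

lemma le_h_product:
  assumes "fuzzy_subset \<mu>" and "x \<in> h_product_level \<mu> \<nu> t"
  shows "t \<le> (\<mu> \<odot>\<^sub>h \<nu>) x"
proof -
  obtain v where v: "v \<in> h_product_values \<mu> \<nu> x" "t \<le> v"
    using assms(2) h_product_level_iff by blast
  \<comment> \<open>The bound 1 makes the real supremum meaningful as an upper bound.\<close>
  have "v \<le> Sup (h_product_values \<mu> \<nu> x)"
    using v(1) h_product_values_le_one[OF assms(1)]
    by (intro cSup_upper bdd_aboveI[of _ 1])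
  with v show ?thesis
    unfolding h_product_def by auto
qed

lemma h_product_nonneg:
  assumes "fuzzy_subset \<mu>" and "fuzzy_subset \<nu>"
  shows "0 \<le> (\<mu> \<odot>\<^sub>h \<nu>) x"
proof (cases "h_product_values \<mu> \<nu> x = {}")
  case True
  then show ?thesis by (simp add: h_product_def)
next
  case False
  \<comment> \<open>At threshold 0 every element qualifies as a factor, so any expression for
    \<open>x\<close>, whatever its value \<open>v\<close>, also witnesses level 0.\<close>
  have "level \<mu> 0 = UNIV" "level \<nu> 0 = UNIV"
    using assms by (auto simp: fuzzy_subset_def level_def)
  moreover obtain v where "x \<in> h_product_level \<mu> \<nu> v"
    using False h_product_level_iff by blast
  then obtain s s' z where "s \<in> product_sums (level \<mu> v) (level \<nu> v)"
    "s' \<in> product_sums (level \<mu> v) (level \<nu> v)" "x + s + z = s' + z"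
    unfolding h_product_level_def by (rule h_closureE)
  moreover have "product_sums (level \<mu> v) (level \<nu> v) \<subseteq> product_sums UNIV UNIV"
    by (simp add: product_sums_mono)
  ultimately have "x \<in> h_product_level \<mu> \<nu> 0"
    unfolding h_product_level_def by (metis h_closureI subsetD)
  then show ?thesis
    using le_h_product assms(1) by blast
qed

lemma less_h_product:
  assumes "0 \<le> t" and "t < (\<mu> \<odot>\<^sub>h \<nu>) x"
  shows "x \<in> h_product_level \<mu> \<nu> t"
proof -
  \<comment> \<open>Since \<open>0 \<le> t\<close>, the strict inequality excludes the default value
    0 of \<open>h_product\<close>.\<close>
  have "h_product_values \<mu> \<nu> x \<noteq> {}" "t < Sup (h_product_values \<mu> \<nu> x)"
    using assms by (auto simp: h_product_def split: if_splits)
  then obtain v where "v \<in> h_product_values \<mu> \<nu> x" "t < v"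
    using less_cSupD by blast
  then show ?thesis
    using h_product_level_iff less_imp_le by blast
qed

text \<open>Lower bounds on a product are tested at thresholds strictly below the target, where
  \<open>less_h_product\<close> supplies an actual expression. Restricting to nonnegative thresholds
  matches that lemma; \<open>0 \<le> w\<close> settles the case \<open>u \<le> 0\<close>.\<close>

lemma le_if_nonneg_dense:
  fixes u w :: real
  assumes "0 \<le> w" and "\<And>t. 0 \<le> t \<Longrightarrow> t < u \<Longrightarrow> t \<le> w"
  shows "u \<le> w"
proof (cases "u \<le> 0")
  case True
  then show ?thesis using assms(1) by simp
next
  case False
  show ?thesis
  proof (rule dense_le_bounded)
    show "0 < u" using False by simp
    show "t \<le> w" if "0 < t" "t < u" for t
      using that by (intro assms(2) less_imp_le)
  qed
qed

section \<open>The intrinsic product as a fuzzy h-ideal\<close>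

lemma level_mult:
  assumes "fuzzy_h_ideal \<mu>" and "x \<in> level \<mu> t"
  shows "x * y \<in> level \<mu> t" and "y * x \<in> level \<mu> t"
proof -
  have "t \<le> \<mu> x" "\<mu> x \<le> \<mu> (x * y)" "\<mu> x \<le> \<mu> (y * x)"
    using assms by (simp_all add: fuzzy_h_ideal_def level_def)
  then show "x * y \<in> level \<mu> t" and "y * x \<in> level \<mu> t"
    by (simp_all add: level_def)
qed

text \<open>Each clause reduces to stability of \<open>h_product_level\<close> at a fixed threshold.
  Right multiplication is absorbed by the level sets of \<nu>, left multiplication by those of
  \<mu>.\<close>

lemma fuzzy_h_ideal_h_product:
  assumes \<mu>: "fuzzy_h_ideal \<mu>" and \<nu>: "fuzzy_h_ideal \<nu>"
  shows "fuzzy_h_ideal (\<mu> \<odot>\<^sub>h \<nu>)"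
proof -
  have fuzzy: "fuzzy_subset \<mu>" "fuzzy_subset \<nu>"
    using assms by (auto simp: fuzzy_h_ideal_def)
  let ?p = "\<mu> \<odot>\<^sub>h \<nu>"
  note lower = h_product_nonneg[OF fuzzy]
  have upper: "?p x \<le> 1" for x
    using h_product_values_le_one[OF fuzzy(1)] by (auto simp: h_product_def intro: cSup_least)
  have add: "min (?p a) (?p b) \<le> ?p (a + b)" for a b
  proof (rule le_if_nonneg_dense[OF lower])
    fix t assume "0 \<le> t" "t < min (?p a) (?p b)"
    then have "a \<in> h_product_level \<mu> \<nu> t" "b \<in> h_product_level \<mu> \<nu> t"
      by (auto intro: less_h_product)
    then have "a + b \<in> h_product_level \<mu> \<nu> t"
      unfolding h_product_level_def by (intro h_closure_add product_sums_add)
    then show "t \<le> ?p (a + b)"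
      by (rule le_h_product[OF fuzzy(1)])
  qed
  have mult_right: "?p a \<le> ?p (a * b)" for a b
  proof (rule le_if_nonneg_dense[OF lower])
    fix t assume "0 \<le> t" "t < ?p a"
    then have "a \<in> h_product_level \<mu> \<nu> t"
      by (rule less_h_product)
    then have "a * b \<in> h_product_level \<mu> \<nu> t"
      unfolding h_product_level_def
      by (intro h_closure_mult_right product_sums_mult_right level_mult[OF \<nu>])
    then show "t \<le> ?p (a * b)"
      by (rule le_h_product[OF fuzzy(1)])
  qed
  have mult_left: "?p b \<le> ?p (a * b)" for a b
  proof (rule le_if_nonneg_dense[OF lower])
    fix t assume "0 \<le> t" "t < ?p b"
    then have "b \<in> h_product_level \<mu> \<nu> t"
      by (rule less_h_product)
    then have "a * b \<in> h_product_level \<mu> \<nu> t"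
      unfolding h_product_level_def
      by (intro h_closure_mult_left product_sums_mult_left level_mult[OF \<mu>])
    then show "t \<le> ?p (a * b)"
      by (rule le_h_product[OF fuzzy(1)])
  qed
  have cancel: "min (?p a) (?p b) \<le> ?p x" if eq: "x + a + y = b + y" for a b x y
  proof (rule le_if_nonneg_dense[OF lower])
    fix t assume "0 \<le> t" "t < min (?p a) (?p b)"
    then have "a \<in> h_product_level \<mu> \<nu> t" "b \<in> h_product_level \<mu> \<nu> t"
      by (auto intro: less_h_product)
    then have "x \<in> h_product_level \<mu> \<nu> t"
      unfolding h_product_level_def
      by (intro h_closure_cancel[OF _ _ _ eq] product_sums_add)
    then show "t \<le> ?p x"
      by (rule le_h_product[OF fuzzy(1)])
  qed
  show ?thesis
    unfolding fuzzy_h_ideal_def fuzzy_subset_def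
    by (intro conjI allI impI lower upper add mult_right mult_left cancel)
qed

section \<open>Comparison of the product with its left factor\<close>

lemma product_sums_level_subset:
  assumes \<mu>: "fuzzy_h_ideal \<mu>" and "s \<in> product_sums (level \<mu> t) B"
  shows "s \<in> level \<mu> t"
  using assms(2)
proof induction
  case (prod a b)
  then show ?case by (intro level_mult[OF \<mu>])
next
  case (add_prod s a b)
  then have "t \<le> min (\<mu> s) (\<mu> (a * b))"
    using level_mult(1)[OF \<mu>, of a t b] by (simp add: level_def)
  also have "\<dots> \<le> \<mu> (s + a * b)"
    using \<mu> unfolding fuzzy_h_ideal_def by blast
  finally show ?case
    by (simp add: level_def)
qed

text \<open>Both sums in an expression at threshold \<open>t\<close> lie in
  \<open>level \<mu> t\<close>, and the cancellation clause for \<mu> passes the bound on to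
  \<open>x\<close>.\<close>

lemma h_product_le_left:
  assumes \<mu>: "fuzzy_h_ideal \<mu>"
  shows "\<mu> \<odot>\<^sub>h \<nu> \<le> \<mu>"
proof (rule le_funI)
  fix x
  show "(\<mu> \<odot>\<^sub>h \<nu>) x \<le> \<mu> x"
  proof (rule le_if_nonneg_dense)
    show "0 \<le> \<mu> x"
      using \<mu> by (simp add: fuzzy_h_ideal_def fuzzy_subset_def)
    fix t assume "0 \<le> t" "t < (\<mu> \<odot>\<^sub>h \<nu>) x"
    then have "x \<in> h_product_level \<mu> \<nu> t"
      by (rule less_h_product)
    then obtain s s' z where s: "s \<in> product_sums (level \<mu> t) (level \<nu> t)"
      "s' \<in> product_sums (level \<mu> t) (level \<nu> t)" "x + s + z = s' + z"
      unfolding h_product_level_def by (rule h_closureE)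
    have "t \<le> min (\<mu> s) (\<mu> s')"
      using s(1,2)[THEN product_sums_level_subset[OF \<mu>]] by (simp add: level_def)
    also have "\<dots> \<le> \<mu> x"
      using \<mu> s(3) unfolding fuzzy_h_ideal_def by blast
    finally show "t \<le> \<mu> x" .
  qed
qed

text \<open>Absorption applied to \<open>x * 0 = 0\<close>.\<close>

lemma fuzzy_h_ideal_le_zero:
  assumes "fuzzy_h_ideal \<mu>"
  shows "\<mu> x \<le> \<mu> 0"
  using assms unfolding fuzzy_h_ideal_def by (metis mult_zero_right)

text \<open>The trivial expression \<open>0 + 0 * 0 + 0 = 0 * 0 + 0\<close> already has value
  \<open>\<mu> 0\<close>.\<close>

lemma h_product_self_zero:
  assumes "fuzzy_h_ideal \<mu>"
  shows "\<mu> 0 \<le> (\<mu> \<odot>\<^sub>h \<mu>) 0"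
proof (rule le_h_product)
  show "fuzzy_subset \<mu>"
    using assms by (simp add: fuzzy_h_ideal_def)
  have "0 * 0 \<in> product_sums (level \<mu> (\<mu> 0)) (level \<mu> (\<mu> 0))"
    by (intro product_sums.prod) (simp_all add: level_def)
  then show "0 \<in> h_product_level \<mu> \<mu> (\<mu> 0)"
    unfolding h_product_level_def by (intro h_closureI[of 0 "0 * 0" 0 "0 * 0"]) auto
qed

section \<open>Idempotence against semiprimeness\<close>

theorem theorem6p5:
  shows "(\<forall>\<mu>::'a::semiring_0 \<Rightarrow> real. fuzzy_h_ideal \<mu> \<longrightarrow> idempotent_fuzzy_h_ideal \<mu>) \<longleftrightarrow>
         (\<forall>\<mu>::'a \<Rightarrow> real. fuzzy_h_ideal \<mu> \<and> nonconstant \<mu> \<longrightarrow> semiprime_fuzzy_h_ideal \<mu>)"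
proof
  assume "\<forall>\<mu>::'a \<Rightarrow> real. fuzzy_h_ideal \<mu> \<longrightarrow> idempotent_fuzzy_h_ideal \<mu>"
  \<comment> \<open>Idempotence of the test ideal \<delta> turns the premise
    \<open>\<delta> \<odot>\<^sub>h \<delta> \<le> \<mu>\<close> into
    \<open>\<delta> \<le> \<mu>\<close>.\<close>
  then show "\<forall>\<mu>::'a \<Rightarrow> real. fuzzy_h_ideal \<mu> \<and> nonconstant \<mu> \<longrightarrow> semiprime_fuzzy_h_ideal \<mu>"
    unfolding idempotent_fuzzy_h_ideal_def semiprime_fuzzy_h_ideal_def by metis
next
  assume semiprime:
    "\<forall>\<mu>::'a \<Rightarrow> real. fuzzy_h_ideal \<mu> \<and> nonconstant \<mu> \<longrightarrow> semiprime_fuzzy_h_ideal \<mu>"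
  show "\<forall>\<mu>::'a \<Rightarrow> real. fuzzy_h_ideal \<mu> \<longrightarrow> idempotent_fuzzy_h_ideal \<mu>"
  proof (intro allI impI)
    fix \<mu> :: "'a \<Rightarrow> real"
    assume \<mu>: "fuzzy_h_ideal \<mu>"
    have "\<mu> \<le> \<mu> \<odot>\<^sub>h \<mu>"
    proof (cases "nonconstant (\<mu> \<odot>\<^sub>h \<mu>)")
      case True
      then have "semiprime_fuzzy_h_ideal (\<mu> \<odot>\<^sub>h \<mu>)"
        using semiprime fuzzy_h_ideal_h_product[OF \<mu> \<mu>] by blast
      then show ?thesis
        using \<mu> unfolding semiprime_fuzzy_h_ideal_def by blast
    next
      case False
      then have const: "(\<mu> \<odot>\<^sub>h \<mu>) x = (\<mu> \<odot>\<^sub>h \<mu>) 0" for x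
        unfolding nonconstant_def by metis
      show ?thesis
      proof (rule le_funI)
        fix x
        show "\<mu> x \<le> (\<mu> \<odot>\<^sub>h \<mu>) x"
          using fuzzy_h_ideal_le_zero[OF \<mu>, of x] h_product_self_zero[OF \<mu>] const[of x]
          by linarith
      qed
    qed
    then show "idempotent_fuzzy_h_ideal \<mu>"
      using \<mu> h_product_le_left[OF \<mu>] unfolding idempotent_fuzzy_h_ideal_def
      by (simp add: order_antisym)
  qed
qed

end
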